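(* Let $\mathcal{T}=\{(a,b)\in\mathbb{R}^2: 0\le a<b\le 1\}$ and let $H:\mathcal{T}\to\mathbb{R}$ be given. For $0\le a<b<c\le 1$ let $$M=M(a,b,c)=\begin{bmatrix} H(b,c) & H(a,c) & H(a,b)\\ a & b & c\\ 1 & 1 & 1\end{bmatrix}.$$ The following are equivalent: 1. There exists some $f:[0,1]\to\mathbb{R}$ such that $\mathrm{DQ}_f(a,b)=H(a,b)$ for all $(a,b)\in\mathcal{T}$. 2. For all $0\le a<b<c\le 1$, $\det(M)=0$. 3. For all $0\le a<b<c\le 1$, the rank of $M$ is $2$. 4. For all $0\le a<b<c\le 1$, the null space of $M$ is $$\operatorname{Null}(M)=\left\{k\begin{bmatrix}\frac{b-c}{c-a}\\ 1\\ \frac{a-b}{c-a}\end{bmatrix}: k\in\mathbb{R}\right\}.$$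
   Context: For a function $f:[0,1]\to\mathbb{R}$, the difference quotient of $f$ is the function $\mathrm{DQ}_f$ on $\mathcal{T}$ given by $\mathrm{DQ}_f(a,b)=\dfrac{f(b)-f(a)}{b-a}$. $\operatorname{Null}(M)$ denotes $\{v\in\mathbb{R}^3: Mv=0\}$. All variables and functions are real-valued. *)

theory Defs
  imports "HOL-Analysis.Analysis"
begin

definition triT :: "(real \<times> real) set" where
  "triT = {(a, b). 0 \<le> a \<and> a < b \<and> b \<le> 1}"

text \<open>
  Functions on \<open>[0,1]\<close> and on \<open>triT\<close> are represented by total functions;
  only their values on these domains matter.
\<close>

definition DQ :: "(real \<Rightarrow> real) \<Rightarrow> real \<times> real \<Rightarrow> real" where
  "DQ f = (\<lambda>(a, b). (f b - f a) / (b - a))"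

definition matM :: "(real \<times> real \<Rightarrow> real) \<Rightarrow> real \<Rightarrow> real \<Rightarrow> real \<Rightarrow> real^3^3" where
  "matM H a b c = vector [vector [H (b, c), H (a, c), H (a, b)],
                          vector [a, b, c],
                          vector [1, 1, 1]]"

definition Null :: "real^3^3 \<Rightarrow> (real^3) set" where
  "Null M = {v. M *v v = 0}"

end

theory Submission
  imports Defs
begin

text \<open>
  Everything rests on the identity
  \<open>det M = (c - a) H(a,c) - (c - b) H(b,c) - (b - a) H(a,b)\<close>.  So \<open>det M\<close> vanishes for all
  \<open>a < b < c\<close> exactly when the increment \<open>(b - a) H(a,b)\<close> is additive over adjacent intervals.
  Increments \<open>f b - f a\<close> of a function are additive; conversely, an additive increment is that of
  its own primitive based at \<open>0\<close>, namely \<open>f x = x H(0,x)\<close>.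

  The other two equivalences hold for each triple \<open>a < b < c\<close> separately.  The rows \<open>(a,b,c)\<close> and
  \<open>(1,1,1)\<close> are independent because \<open>a \<noteq> b\<close>, so the rank is at least \<open>2\<close>, and it is less than \<open>3\<close>
  exactly when \<open>det M = 0\<close>.  The vectors annihilated by these two rows form the line through
  \<open>w = ((b-c)/(c-a), 1, (a-b)/(c-a))\<close>, so the null space is this whole line or just \<open>0\<close>, according
  to whether the first row annihilates \<open>w\<close>; and the first row applied to \<open>w\<close> gives
  \<open>det M / (c - a)\<close>.
\<close>

lemma det_matM:
  "det (matM H a b c) = (c - a) * H (a, c) - (c - b) * H (b, c) - (b - a) * H (a, b)"
  by (simp add: det_3 matM_def algebra_simps)

lemma matM_mult_vec:
  "matM H a b c *v v = vector [H (b, c) * v$1 + H (a, c) * v$2 + H (a, b) * v$3,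
     a * v$1 + b * v$2 + c * v$3, v$1 + v$2 + v$3]"
  by (simp add: vec_eq_iff forall_3 matrix_vector_mult_def sum_3 matM_def)

lemma DQ_of_primitive:
  assumes additive: "\<And>a b c. \<lbrakk>0 \<le> a; a < b; b < c; c \<le> 1\<rbrakk> \<Longrightarrow>
      (c - a) * H (a, c) = (c - b) * H (b, c) + (b - a) * H (a, b)"
    and ab: "0 \<le> a" "a < b" "b \<le> 1"
  shows "DQ (\<lambda>x. x * H (0, x)) (a, b) = H (a, b)"
proof (cases "a = 0")
  case True
  then show ?thesis using ab by (simp add: DQ_def)
next
  case False
  then have "b * H (0, b) - a * H (0, a) = (b - a) * H (a, b)"
    using additive[of 0 a b] ab by simp
  then show ?thesis using ab by (simp add: DQ_def)
qed

lemma rank_matM_ge_2: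
  assumes "a \<noteq> b"
  shows "2 \<le> rank (matM H a b c)"
proof -
  let ?M = "matM H a b c"
  have r2: "row 2 ?M = vector [a, b, c]" and r3: "row 3 ?M = vector [1, 1, 1]"
    by (simp_all add: row_def matM_def vec_eq_iff)
  have ne: "row 2 ?M \<noteq> row 3 ?M" and nz: "row 3 ?M \<noteq> 0"
    using assms by (auto simp: r2 r3 vec_eq_iff forall_3)
  have "row 2 ?M \<notin> span {row 3 ?M}"
    using assms by (auto simp: span_singleton r2 r3 vec_eq_iff forall_3)
  then have "independent {row 2 ?M, row 3 ?M}"
    using nz by (simp add: independent_insert)
  moreover have "{row 2 ?M, row 3 ?M} \<subseteq> rows ?M"
    by (auto simp: rows_def)
  ultimately have "card {row 2 ?M, row 3 ?M} \<le> dim (rows ?M)"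
    by (metis dim_eq_card_independent dim_subset)
  then show ?thesis using ne by (simp add: row_rank_def)
qed

lemma det_matM_eq_0_iff_rank:
  assumes "a \<noteq> b"
  shows "det (matM H a b c) = 0 \<longleftrightarrow> rank (matM H a b c) = 2"
  using rank_matM_ge_2[OF assms, of H c] det_eq_0_rank[of "matM H a b c"] by auto

lemma last_rows_annihilate_direction:
  fixes a b c :: real
  assumes "a < c"
  shows "a * ((b - c) / (c - a)) + b + c * ((a - b) / (c - a)) = 0"
    and "(b - c) / (c - a) + 1 + (a - b) / (c - a) = 0"
proof -
  define p q where "p = (b - c) / (c - a)" and "q = (a - b) / (c - a)"
  have "p * (c - a) = b - c" "q * (c - a) = a - b"
    using assms by (simp_all add: p_def q_def)
  moreover from this have "(p + 1 + q) * (c - a) = 0"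
    by (simp add: algebra_simps)
  then have "p + 1 + q = 0"
    using assms by simp
  ultimately have "a * p + b + c * q = 0"
    by algebra
  with \<open>p + 1 + q = 0\<close> show "a * ((b - c) / (c - a)) + b + c * ((a - b) / (c - a)) = 0"
      "(b - c) / (c - a) + 1 + (a - b) / (c - a) = 0"
    by (simp_all add: p_def q_def)
qed

text \<open>
  As \<open>a \<noteq> c\<close>, the equations of the last two rows determine \<open>v$1\<close> and \<open>v$3\<close>
  from \<open>v$2\<close>, which is why the middle coordinate serves as the parameter of the line.
\<close>

lemma last_rows_annihilate_iff:
  fixes v :: "real^3"
  assumes "a < c"
  shows "a * v$1 + b * v$2 + c * v$3 = 0 \<and> v$1 + v$2 + v$3 = 0 \<longleftrightarrow>
    v = v$2 *\<^sub>R vector [(b - c) / (c - a), 1, (a - b) / (c - a)]" (is "?L \<longleftrightarrow> ?R")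
proof
  assume L: ?L
  then have v3: "v$3 = - v$1 - v$2" by simp
  have "v$1 * (c - a) = v$2 * (b - c)" "v$3 * (c - a) = v$2 * (a - b)"
    using L unfolding v3 by (simp_all add: algebra_simps)
  then show ?R
    using assms by (simp add: vec_eq_iff forall_3 eq_divide_eq)
next
  assume ?R
  then have "v$1 = v$2 * ((b - c) / (c - a))" "v$3 = v$2 * ((a - b) / (c - a))"
    by (metis vector_3 vector_scaleR_component real_scaleR_def)+
  then show ?L
    using last_rows_annihilate_direction[OF assms, of b] by algebra
qed

lemma det_matM_eq_0_iff_Null:
  assumes "a < c"
  shows "det (matM H a b c) = 0 \<longleftrightarrow> Null (matM H a b c) =
    {k *\<^sub>R vector [(b - c) / (c - a), 1, (a - b) / (c - a)] | k. k \<in> (UNIV :: real set)}"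
    (is "_ \<longleftrightarrow> _ = ?line")
proof -
  let ?M = "matM H a b c"
  let ?w = "vector [(b - c) / (c - a), 1, (a - b) / (c - a)] :: real^3"
  have first_row: "H (b, c) * ((b - c) / (c - a)) + H (a, c) + H (a, b) * ((a - b) / (c - a))
      = det ?M / (c - a)"
  proof -
    have "H (a, c) = H (a, c) * (c - a) / (c - a)"
      using assms by simp
    then show ?thesis
      by (simp add: det_matM add_divide_distrib diff_divide_distrib algebra_simps)
  qed
  have Mw: "?M *v ?w = vector [det ?M / (c - a), 0, 0]"
    using first_row last_rows_annihilate_direction[OF assms] by (simp add: matM_mult_vec)
  have w_in_Null: "?w \<in> Null ?M \<longleftrightarrow> det ?M = 0"
    using assms by (simp add: Null_def Mw vec_eq_iff forall_3)
  have Null_subset: "Null ?M \<subseteq> ?line"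
  proof
    fix v assume "v \<in> Null ?M"
    then have "a * v$1 + b * v$2 + c * v$3 = 0 \<and> v$1 + v$2 + v$3 = 0"
      by (simp add: Null_def matM_mult_vec vec_eq_iff forall_3)
    then have "v = v$2 *\<^sub>R ?w"
      using last_rows_annihilate_iff[OF assms] by blast
    then show "v \<in> ?line" by blast
  qed
  show ?thesis
  proof
    assume "det ?M = 0"
    then have "?M *v ?w = 0"
      using w_in_Null by (simp add: Null_def)
    then have "?line \<subseteq> Null ?M"
      by (auto simp: Null_def matrix_vector_mult_scaleR)
    with Null_subset show "Null ?M = ?line" by blast
  next
    assume "Null ?M = ?line"
    moreover have "?w \<in> ?line"
      by (auto intro: exI[of _ 1])
    ultimately show "det ?M = 0"
      using w_in_Null by blast
  qed
qed

theorem corollary3: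
  fixes H :: "real \<times> real \<Rightarrow> real"
  defines "S1 \<equiv> (\<exists>f :: real \<Rightarrow> real. \<forall>(a, b) \<in> triT. DQ f (a, b) = H (a, b))"
    and "S2 \<equiv> (\<forall>a b c. 0 \<le> a \<and> a < b \<and> b < c \<and> c \<le> 1 \<longrightarrow> det (matM H a b c) = 0)"
    and "S3 \<equiv> (\<forall>a b c. 0 \<le> a \<and> a < b \<and> b < c \<and> c \<le> 1 \<longrightarrow> rank (matM H a b c) = 2)"
    and "S4 \<equiv> (\<forall>a b c. 0 \<le> a \<and> a < b \<and> b < c \<and> c \<le> 1 \<longrightarrow>
           Null (matM H a b c) =
             {k *\<^sub>R vector [(b - c) / (c - a), 1, (a - b) / (c - a)] | k. k \<in> (UNIV :: real set)})"
  shows "(S1 \<longleftrightarrow> S2) \<and> (S2 \<longleftrightarrow> S3) \<and> (S3 \<longleftrightarrow> S4)"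
proof (intro conjI)
  show "S1 \<longleftrightarrow> S2"
  proof
    assume S1
    then obtain f where f: "\<forall>(a, b) \<in> triT. DQ f (a, b) = H (a, b)"
      unfolding S1_def by blast
    have increment: "(b - a) * H (a, b) = f b - f a" if "0 \<le> a" "a < b" "b \<le> 1" for a b
    proof -
      have "H (a, b) = (f b - f a) / (b - a)"
        using f that by (force simp: triT_def DQ_def)
      then show ?thesis using that by simp
    qed
    show S2
      unfolding S2_def by (simp add: det_matM increment)
  next
    assume S2
    have "(c - a) * H (a, c) = (c - b) * H (b, c) + (b - a) * H (a, b)"
      if "0 \<le> a" "a < b" "b < c" "c \<le> 1" for a b c
    proof -
      have "det (matM H a b c) = 0"
        using \<open>S2\<close> that unfolding S2_def by blast
      then show ?thesis by (simp add: det_matM)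
    qed
    then have "DQ (\<lambda>x. x * H (0, x)) (a, b) = H (a, b)" if "(a, b) \<in> triT" for a b
      using that by (intro DQ_of_primitive) (auto simp: triT_def)
    then show S1
      unfolding S1_def by (intro exI[of _ "\<lambda>x. x * H (0, x)"]) auto
  qed
  have S2_S4: "S2 \<longleftrightarrow> S4"
    unfolding S2_def S4_def using det_matM_eq_0_iff_Null[of _ _ H]
    by (meson less_trans)
  show S2_S3: "S2 \<longleftrightarrow> S3"
    unfolding S2_def S3_def using det_matM_eq_0_iff_rank[of _ _ H]
    by (metis less_irrefl)
  show "S3 \<longleftrightarrow> S4"
    using S2_S3 S2_S4 by blast
qed

end
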